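(* Let $\{a_n\}$ be an unbounded sublacunary increasing sequence of real numbers. For each $\epsilon \in (0,1]$, there exists a $(1-\epsilon)$-large set $S \subset \mathbb{R}$ that does not contain any affine copy of $\{a_n\}$.
   Context: A sequence $\{a_n\}$ is sublacunary if $\lim_{n\to\infty} a_{n+1}/a_n = 1$. $|A|$ denotes the Lebesgue measure of a measurable set $A \subseteq \mathbb{R}$. For $\epsilon \in (0,1]$, a $(1-\epsilon)$-large set is a Lebesgue measurable set $S \subseteq \mathbb{R}$ such that $|S \cap I| \geq 1-\epsilon$ for every interval $I \subset \mathbb{R}$ of unit length. An affine copy of $\{a_n\}$ is a set of the form $x\{a_n\} + t = \{x a_n + t\}$ (over all indices $n$) with $x \in \mathbb{R} \setminus \{0\}$ and $t \in \mathbb{R}$. *)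

theory Defs
  imports "HOL-Analysis.Analysis"
begin

(* Since x / 0 = 0, a limit of 1 forces a n to be nonzero for all large n,
   so the ratio is a genuine quotient wherever it affects the limit. *)
definition sublacunary :: "(nat \<Rightarrow> real) \<Rightarrow> bool" where
  "sublacunary a \<longleftrightarrow> (\<lambda>n. a (Suc n) / a n) \<longlonglongrightarrow> 1"

(* The intervals I may be open, closed or half-open.  S \<inter> I has finite measure,
   so the real-valued measure is not affected by its default value on sets of infinite measure. *)
definition large_set :: "real \<Rightarrow> real set \<Rightarrow> bool" where
  "large_set c S \<longleftrightarrow>
     S \<in> sets lebesgue \<and>
     (\<forall>I. is_interval I \<and> emeasure lebesgue I = 1 \<longrightarrow> measure lebesgue (S \<inter> I) \<ge> c)"

definition affine_copy :: "(nat \<Rightarrow> real) \<Rightarrow> real set \<Rightarrow> bool" where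
  "affine_copy a C \<longleftrightarrow> (\<exists>x t. x \<noteq> 0 \<and> C = range (\<lambda>n. x * a n + t))"

end

theory Submission
  imports Defs
begin

text \<open>
  The set \<open>S\<close> is the complement of a set \<open>H \<union> uminus ` H\<close>, where \<open>H\<close> has small measure in every unit
  interval but meets every sequence \<open>x * a n + t\<close> with \<open>x > 0\<close>; its mirror image deals with
  \<open>x < 0\<close>.

  It suffices to treat countably many small boxes of parameters \<open>(x, t)\<close> one at a time. For a single
  box only finitely many terms of the sequence are used, and these can be taken as far out as desired.
  So the pieces of \<open>H\<close> that belong to different boxes can be placed more than a unit apart from each
  other: a unit interval then meets at most one piece, and the densities of the pieces do not add up.
  For this reason every piece may have the same density, of order \<open>1 / q\<close> for a fixed large \<open>q\<close>.

  In a box, \<open>t\<close> varies by at most \<open>1 / q\<close> and \<open>x\<close> by a factor of at most \<open>1 + \<eta>\<close> with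
  \<open>\<eta> = 1 / (4 * q)\<close>. As consecutive ratios of the sequence tend to \<open>1\<close>, there is a subsequence \<open>b\<close>
  whose ratios lie between \<open>1 + 2 * \<eta>\<close> and \<open>1 + 3 * \<eta>\<close> (\<open>geometric_subsequence\<close>). For large \<open>b 0\<close>,
  the lower bound makes the ranges of \<open>x * b n + t\<close> over the box disjoint for different \<open>n\<close>, so that the piece can be
  chosen independently in each range. There it is a comb: a \<open>1\<close>-periodic set, one of \<open>q\<close> translates
  of each other, whose teeth have length \<open>3 / q\<close>. For each point \<open>y\<close>, one of the \<open>q\<close> combs contains
  all of \<open>{y..y + 2 / q}\<close>, so by the pigeonhole principle some comb catches at least a share \<open>1 / q\<close> of any finite set
  of parameters that have not been hit yet (\<open>greedy_hitting\<close>). After \<open>N\<close> steps at most a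
  share \<open>(1 - 1 / q) ^ N\<close> of the parameters survives. To control all \<open>x\<close> in the box up to an error of
  \<open>1 / q\<close> in \<open>x * b n\<close>, a grid of about \<open>q * b N\<close> parameters is enough, and \<open>b N\<close> grows at most like
  \<open>(1 + 3 * \<eta>) ^ N\<close>. Since \<open>(1 + 3 * \<eta>) * (1 - 1 / q) < 1\<close>, nothing survives once \<open>N\<close> is large.
\<close>

section \<open>Greedy choice of colours\<close>

lemma pigeonhole_survivors:
  fixes c :: "'a \<Rightarrow> nat"
  assumes "finite P" and "q > 0" and "\<And>p. p \<in> P \<Longrightarrow> c p < q"
  shows "\<exists>r<q. real (card {p \<in> P. c p \<noteq> r}) \<le> real (card P) * (1 - 1 / real q)"
proof (rule ccontr)
  assume *: "\<not> ?thesis"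
  have split: "card {p \<in> P. c p = r} + card {p \<in> P. c p \<noteq> r} = card P" for r
    using assms(1) by (subst card_Un_disjoint [symmetric]) (auto intro!: arg_cong[of _ _ card])
  have "real (card {p \<in> P. c p = r}) < real (card P) / q" if "r < q" for r
    using * that split[of r] by (auto simp: algebra_simps simp flip: of_nat_add)
  then have "(\<Sum>r<q. real (card {p \<in> P. c p = r})) < (\<Sum>r<q. real (card P) / q)"
    using assms(2) by (intro sum_strict_mono) auto
  moreover have "(\<Sum>r<q. real (card {p \<in> P. c p = r})) = real (card P)"
    using sum.group[of P "{..<q}" c "\<lambda>_. 1::real"] assms by fastforce
  ultimately show False
    using assms(2) by simp
qed

text \<open>
  Colour \<open>r n\<close> is the most frequent value of \<open>c n\<close> among the points that avoided the colours chosen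
  before, so each step removes at least a share \<open>1 / q\<close> of the points that are left.
\<close>

lemma greedy_survivors:
  fixes c :: "nat \<Rightarrow> 'a \<Rightarrow> nat"
  assumes "finite P" and "q > 0" and c: "\<And>n p. p \<in> P \<Longrightarrow> c n p < q"
  shows "\<exists>r. real (card {p \<in> P. \<forall>n<N. c n p \<noteq> r n}) \<le> real (card P) * (1 - 1 / real q) ^ N"
proof (induction N)
  case (Suc N)
  then obtain r where r: "real (card {p \<in> P. \<forall>n<N. c n p \<noteq> r n})
      \<le> real (card P) * (1 - 1 / real q) ^ N"
    by blast
  define A where "A = {p \<in> P. \<forall>n<N. c n p \<noteq> r n}"
  obtain s where s: "real (card {p \<in> A. c N p \<noteq> s}) \<le> real (card A) * (1 - 1 / real q)"
    using pigeonhole_survivors[of A q "c N"] assms by (auto simp: A_def)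
  have "{p \<in> P. \<forall>n<Suc N. c n p \<noteq> (r(N := s)) n} = {p \<in> A. c N p \<noteq> s}"
    by (auto simp: A_def less_Suc_eq)
  moreover have "real (card A) * (1 - 1 / real q)
      \<le> real (card P) * (1 - 1 / real q) ^ N * (1 - 1 / real q)"
    using r assms(2) unfolding A_def by (intro mult_right_mono) auto
  ultimately show ?case
    using s by (intro exI[of _ "r(N := s)"]) (simp add: mult_ac)
qed simp

lemma greedy_hitting:
  fixes c :: "nat \<Rightarrow> 'a \<Rightarrow> nat"
  assumes "finite P" and "q > 0" and "\<And>n p. p \<in> P \<Longrightarrow> c n p < q"
    and "real (card P) * (1 - 1 / real q) ^ N < 1"
  obtains r where "\<And>p. p \<in> P \<Longrightarrow> \<exists>n<N. c n p = r n"
proof -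
  obtain r where "real (card {p \<in> P. \<forall>n<N. c n p \<noteq> r n}) \<le> real (card P) * (1 - 1 / real q) ^ N"
    using greedy_survivors[of P q c N] assms(1-3) by blast
  then have "card {p \<in> P. \<forall>n<N. c n p \<noteq> r n} = 0"
    using assms(4) by linarith
  then have "{p \<in> P. \<forall>n<N. c n p \<noteq> r n} = {}"
    using assms(1) by simp
  then show thesis
    by (intro that[of r]) blast
qed

section \<open>Subsequences of nearly geometric growth\<close>

text \<open>
  The next term is the first one to reach \<open>\<sigma>\<close> times the current one. Its predecessor is still
  below this level, and far out one step multiplies by less than \<open>\<rho> / \<sigma>\<close>, so the level is
  overshot to at most \<open>\<rho>\<close> times the current term.
\<close>

lemma geometric_subsequence:
  fixes a :: "nat \<Rightarrow> real"
  assumes inc: "incseq a" and unb: "\<not> bounded (range a)" and sub: "sublacunary a"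
    and "1 < \<sigma>" and "\<sigma> < \<rho>"
  obtains g where "B \<le> a (g 0)" and "0 < a (g 0)"
    and "\<And>n. \<sigma> * a (g n) \<le> a (g (Suc n))" and "\<And>n. a (g (Suc n)) \<le> \<rho> * a (g n)"
proof -
  have large: "\<exists>m\<ge>k. y \<le> a m" for y k
  proof (rule ccontr)
    assume *: "\<not> ?thesis"
    have "a m \<le> y" for m
      using * incseqD[OF inc, of m "max m k"] by (meson linear max.cobounded1 max.cobounded2 order_trans)
    then have "range a \<subseteq> {a 0..y}"
      using inc by (auto intro: incseqD)
    then show False
      using unb bounded_subset bounded_closed_interval by blast
  qed
  have "1 < \<rho> / \<sigma>"
    using assms by simp
  then have "\<forall>\<^sub>F n in sequentially. a (Suc n) / a n < \<rho> / \<sigma>"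
    using sub unfolding sublacunary_def by (rule order_tendstoD(2)[rotated])
  then obtain n0 where n0: "\<And>n. n \<ge> n0 \<Longrightarrow> a (Suc n) / a n < \<rho> / \<sigma>"
    by (auto simp: eventually_sequentially)
  obtain n1 where n1: "n1 \<ge> n0" "max B 1 \<le> a n1"
    using large by blast
  have pos: "0 < a n" if "n \<ge> n1" for n
    using n1 incseqD[OF inc that] by linarith
  have "\<exists>k\<ge>n1. \<sigma> * a m \<le> a k \<and> a k \<le> \<rho> * a m" if m: "n1 \<le> m" for m
  proof -
    define k where "k = (LEAST k. \<sigma> * a m \<le> a k)"
    have k: "\<sigma> * a m \<le> a k"
      unfolding k_def using large[of 0 "\<sigma> * a m"] by (auto intro: LeastI_ex)
    have am: "a m < \<sigma> * a m"
      using pos[OF m] assms(4) by simp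
    have "m < k"
    proof (rule ccontr)
      assume "\<not> m < k"
      then have "a k \<le> a m"
        using incseqD[OF inc] by simp
      then show False
        using k am by linarith
    qed
    then obtain j where j: "k = Suc j" "m \<le> j"
      by (cases k) auto
    have "a j < \<sigma> * a m"
      using not_less_Least[of j "\<lambda>k. \<sigma> * a m \<le> a k"] j k_def by simp
    moreover have "a k \<le> \<rho> / \<sigma> * a j"
      using n0[of j] pos[of j] j m n1 by (simp add: divide_less_eq)
    moreover have "\<rho> / \<sigma> * a j \<le> \<rho> / \<sigma> * (\<sigma> * a m)"
      using calculation(1) assms(4,5) by (intro mult_left_mono) auto
    ultimately have "a k \<le> \<rho> * a m"
      using assms(4) by simp
    then show ?thesis
      using k \<open>m < k\<close> m by (intro exI[of _ k]) auto
  qed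
  then obtain f where f: "\<And>m. n1 \<le> m \<Longrightarrow> n1 \<le> f m \<and> \<sigma> * a m \<le> a (f m) \<and> a (f m) \<le> \<rho> * a m"
    by metis
  define g where "g n = (f ^^ n) n1" for n
  have g: "n1 \<le> g n" "g (Suc n) = f (g n)" for n
  proof -
    show "n1 \<le> g n"
      unfolding g_def using f by (induction n) auto
  qed (simp add: g_def)
  show thesis
  proof (rule that[of g])
    show "B \<le> a (g 0)" "0 < a (g 0)"
      using n1(2) by (auto simp: g_def)
  qed (use f[OF g(1)] g(2) in auto)
qed

section \<open>Sets of small measure in every unit interval\<close>

definition thin :: "real \<Rightarrow> real set \<Rightarrow> bool" where
  "thin d H \<longleftrightarrow> H \<in> sets borel \<and> (\<forall>c. measure lebesgue (H \<inter> {c..c + 1}) \<le> d)"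

lemma thin_empty: "0 \<le> d \<Longrightarrow> thin d {}"
  by (simp add: thin_def)

lemma thin_subset:
  assumes "thin d H" and "G \<subseteq> H" and "G \<in> sets borel"
  shows "thin d G"
  unfolding thin_def
proof (intro conjI allI)
  fix c :: real
  have "measure lebesgue (G \<inter> {c..c + 1}) \<le> measure lebesgue (H \<inter> {c..c + 1})"
    using assms by (intro measure_mono_fmeasurable) (auto simp: thin_def intro!: fmeasurableI2[of "{c..c+1}"])
  then show "measure lebesgue (G \<inter> {c..c + 1}) \<le> d"
    using assms(1) unfolding thin_def by (meson order_trans)
qed (fact assms(3))

text \<open>
  The gaps of length \<open>2\<close> keep a unit interval from meeting two of the sets, so the bound \<open>d\<close> is not
  multiplied by the number of sets, even though there are infinitely many.
\<close>

lemma thin_UN_separated: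
  assumes H: "\<And>n. thin d (H n)" and l: "incseq l"
    and sub: "\<And>n. H n \<subseteq> {l n..l (Suc n) - 2}"
  shows "thin d (\<Union>n. H n)"
  unfolding thin_def
proof (intro conjI allI)
  show "(\<Union>n. H n) \<in> sets borel"
    using H by (auto simp: thin_def)
  fix c :: real
  have apart: "m = n" if "y \<in> H m" "z \<in> H n" "y \<in> {c..c + 1}" "z \<in> {c..c + 1}" for m n y z
  proof -
    have sep: "\<not> i < j" if "y \<in> H i" "z \<in> H j" "\<bar>z - y\<bar> \<le> 1" for i j y z
    proof
      assume "i < j"
      then have "l (Suc i) \<le> l j"
        using incseqD[OF l, of "Suc i" j] by simp
      moreover have "y \<le> l (Suc i) - 2" "l j \<le> z"
        using that sub[of i] sub[of j] by auto
      ultimately show False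
        using that(3) by linarith
    qed
    have "\<bar>z - y\<bar> \<le> 1" "\<bar>y - z\<bar> \<le> 1"
      using that(3,4) by auto
    then show ?thesis
      using sep[OF that(1,2)] sep[OF that(2,1)] by linarith
  qed
  have "\<exists>m. (\<Union>n. H n) \<inter> {c..c + 1} \<subseteq> H m \<inter> {c..c + 1}"
  proof (cases "(\<Union>n. H n) \<inter> {c..c + 1} = {}")
    case False
    then obtain m y where y: "y \<in> H m" "y \<in> {c..c + 1}" by blast
    have "(\<Union>n. H n) \<inter> {c..c + 1} \<subseteq> H m \<inter> {c..c + 1}"
      using apart[OF y(1) _ y(2)] by blast
    then show ?thesis ..
  qed auto
  then obtain m where "(\<Union>n. H n) \<inter> {c..c + 1} \<subseteq> H m \<inter> {c..c + 1}" ..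
  then have "(\<Union>n. H n) \<inter> {c..c + 1} = H m \<inter> {c..c + 1}"
    by auto
  then show "measure lebesgue ((\<Union>n. H n) \<inter> {c..c + 1}) \<le> d"
    using H[of m] by (simp add: thin_def)
qed

lemma thin_uminus:
  assumes "thin d H"
  shows "thin d (uminus ` H)"
  unfolding thin_def
proof (intro conjI allI)
  have eq: "uminus ` H = uminus -` H" by force
  show "uminus ` H \<in> sets borel"
    unfolding eq using assms measurable_sets[of uminus borel borel H] by (auto simp: thin_def)
  fix c :: real
  have "uminus ` H \<inter> {c..c + 1} = (\<lambda>x. (-1) *\<^sub>R x + 0) ` (H \<inter> {- c - 1..- c - 1 + 1})"
    by force
  then have "measure lebesgue (uminus ` H \<inter> {c..c + 1}) = measure lebesgue (H \<inter> {- c - 1..- c - 1 + 1})"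
    using measure_lebesgue_affine[of "-1" 0 "H \<inter> {- c - 1..- c - 1 + 1}"] by simp
  then show "measure lebesgue (uminus ` H \<inter> {c..c + 1}) \<le> d"
    using assms unfolding thin_def by metis
qed

lemma thin_Un:
  assumes "thin d G" and "thin e H"
  shows "thin (d + e) (G \<union> H)"
  unfolding thin_def
proof (intro conjI allI)
  show "G \<union> H \<in> sets borel" using assms by (auto simp: thin_def)
  fix c :: real
  have "measure lebesgue ((G \<inter> {c..c + 1}) \<union> (H \<inter> {c..c + 1}))
      \<le> measure lebesgue (G \<inter> {c..c + 1}) + measure lebesgue (H \<inter> {c..c + 1})"
    using assms by (intro measure_Un_le) (auto simp: thin_def)
  also have "\<dots> \<le> d + e"
    using assms unfolding thin_def by (meson add_mono)
  finally show "measure lebesgue ((G \<union> H) \<inter> {c..c + 1}) \<le> d + e"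
    by (simp add: Int_Un_distrib2)
qed

lemma unit_interval_subset_Icc:
  fixes I :: "real set"
  assumes "is_interval I" and "emeasure lebesgue I = 1"
  obtains c where "I \<subseteq> {c..c + 1}"
proof -
  have meas: "I \<in> sets lebesgue"
    using assms(2) by (metis emeasure_neq_0_sets zero_neq_one)
  have diam: "y - x \<le> 1" if "x \<in> I" "y \<in> I" for x y
  proof (cases "x \<le> y")
    case True
    have "{x..y} \<subseteq> I"
      using assms(1) that unfolding is_interval_1 by (meson atLeastAtMost_iff subsetI)
    then have "emeasure lebesgue {x..y} \<le> emeasure lebesgue I"
      using meas by (rule emeasure_mono)
    then have "ennreal (y - x) \<le> ennreal 1"
      using True assms(2) by simp
    then show ?thesis
      by (subst (asm) ennreal_le_iff) auto
  qed simp
  have "I \<noteq> {}" using assms(2) by auto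
  then obtain z where z: "z \<in> I" by blast
  have bdd: "bdd_below I"
    using diam[OF _ z] by (intro bdd_belowI[of _ "z - 1"]) (simp add: algebra_simps)
  have "y \<in> {Inf I..Inf I + 1}" if "y \<in> I" for y
  proof -
    have "y - 1 \<le> Inf I"
      using \<open>I \<noteq> {}\<close> diam[OF _ that] by (intro cInf_greatest) (auto simp: algebra_simps)
    then show ?thesis
      using cInf_lower[OF that bdd] by auto
  qed
  then show thesis
    by (intro that[of "Inf I"]) blast
qed

text \<open>
  Largeness speaks of open, closed and half-open intervals, while thinness is tested on closed ones
  only; the inclusion \<open>I \<subseteq> {c..c + 1}\<close> bridges the difference.
\<close>

lemma large_set_Compl_thin:
  assumes "thin d H"
  shows "large_set (1 - d) (- H)"
  unfolding large_set_def
proof (intro conjI allI impI)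
  have H: "H \<in> sets lebesgue"
    using assms by (simp add: thin_def)
  then show "- H \<in> sets lebesgue"
    by (simp add: Compl_in_sets_lebesgue)
  fix I :: "real set"
  assume I: "is_interval I \<and> emeasure lebesgue I = 1"
  then have IF: "I \<in> fmeasurable lebesgue"
    by (metis emeasure_neq_0_sets fmeasurableI ennreal_one_less_top infinity_ennreal_def zero_neq_one)
  obtain c where c: "I \<subseteq> {c..c + 1}"
    using I unit_interval_subset_Icc by blast
  have "measure lebesgue (H \<inter> I) \<le> measure lebesgue (H \<inter> {c..c + 1})"
    using c H IF by (intro measure_mono_fmeasurable) (auto intro!: fmeasurableI2[of "{c..c+1}"])
  also have "\<dots> \<le> d"
    using assms by (simp add: thin_def)
  finally have "measure lebesgue (H \<inter> I) \<le> d" .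
  moreover have "measure lebesgue (I - H \<inter> I) = measure lebesgue I - measure lebesgue (H \<inter> I)"
    using H IF by (intro measurable_measure_Diff) auto
  moreover have "I - H \<inter> I = - H \<inter> I" by blast
  moreover have "measure lebesgue I = 1"
    using I by (simp add: measure_def)
  ultimately show "1 - d \<le> measure lebesgue (- H \<inter> I)"
    by simp
qed

section \<open>Periodic combs\<close>

text \<open>
  The cell of colour \<open>r\<close> modulo \<open>1\<close> is \<open>{r / q..<(r + 1) / q}\<close>. A tooth of the comb is this cell
  extended to the right by \<open>2 / q\<close>: a first \<open>1 / q\<close> absorbs the rounding of \<open>x\<close> to a grid and a second
  one the variation of \<open>t\<close> in a box.
\<close>

definition comb :: "nat \<Rightarrow> nat \<Rightarrow> real set" where
  "comb q r = (\<Union>k::int. {k + r / q..<k + (real r + 3) / q})"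

lemma thin_comb:
  assumes "q \<ge> 3"
  shows "thin (6 / q) (comb q r)"
  unfolding thin_def
proof (intro conjI allI)
  show B: "comb q r \<in> sets borel"
    by (auto simp: comb_def)
  fix c :: real
  define T where "T k = {k + r / q..<k + (real r + 3) / q}" for k :: int
  define k where "k = \<lfloor>c - r / q\<rfloor>"
  have tooth: "measure lebesgue (T j) = 3 / q" for j
    using assms by (simp add: T_def add_divide_distrib)
  have T: "T j \<in> lmeasurable" for j
    unfolding T_def by (rule fmeasurableI2[of "{j + r / q..j + (real r + 3) / q}"]) auto
  \<comment> \<open>The teeth are half-open and of length at most \<open>1\<close>, so even a closed unit interval meets at most
    two of them.\<close>
  have "j = k \<or> j = k + 1" if "y \<in> T j" "y \<in> {c..c + 1}" for j y
  proof -
    have "3 / real q \<le> 1" using assms by simp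
    then have "c < j + r / q + 1" "j + r / q \<le> c + 1"
      using that by (auto simp: T_def add_divide_distrib)
    then show ?thesis
      unfolding k_def by linarith
  qed
  then have "comb q r \<inter> {c..c + 1} \<subseteq> T k \<union> T (k + 1)"
    unfolding comb_def T_def by blast
  then have "measure lebesgue (comb q r \<inter> {c..c + 1}) \<le> measure lebesgue (T k \<union> T (k + 1))"
    using B T by (intro measure_mono_fmeasurable) auto
  also have "\<dots> \<le> measure lebesgue (T k) + measure lebesgue (T (k + 1))"
    by (intro measure_Un_le) (auto simp: T_def)
  finally show "measure lebesgue (comb q r \<inter> {c..c + 1}) \<le> 6 / q"
    by (simp add: tooth)
qed


lemma nat_floor_frac_less:
  assumes "q > 0"
  shows "nat \<lfloor>real q * frac y\<rfloor> < q"
proof -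
  have "real q * frac y < real q"
    using assms frac_lt_1[of y] by simp
  then show ?thesis
    using assms by (simp add: nat_less_iff floor_less_iff)
qed

lemma mem_comb_near:
  assumes "q > 0" and "y \<le> z" and "z \<le> y + 2 / q"
  shows "z \<in> comb q (nat \<lfloor>real q * frac y\<rfloor>)"
proof -
  define r where "r = nat \<lfloor>real q * frac y\<rfloor>"
  have "0 \<le> real q * frac y"
    by simp
  then have "real r \<le> real q * frac y" "real q * frac y < real r + 1"
    unfolding r_def by linarith+
  then have "real r / q \<le> frac y" "frac y < (real r + 1) / q"
    using assms(1) by (simp_all add: field_simps)
  moreover have "y = \<lfloor>y\<rfloor> + frac y"
    by (simp add: frac_def)
  ultimately have "z \<in> {\<lfloor>y\<rfloor> + r / q..<\<lfloor>y\<rfloor> + (real r + 3) / q}"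
    using assms by (simp add: add_divide_distrib)
  then show ?thesis
    unfolding comb_def r_def by blast
qed

section \<open>Hitting all affine copies\<close>

text \<open>
  The parameter \<open>T\<close> lets the set be placed to the right of everything constructed before, and the
  upper end \<open>u - 2\<close> leaves the gap that \<open>thin_UN_separated\<close> asks for.
\<close>

lemma exists_thin_hitting_box:
  fixes a :: "nat \<Rightarrow> real" and q :: nat
  assumes inc: "incseq a" and unb: "\<not> bounded (range a)" and sub: "sublacunary a"
    and q: "q \<ge> 3" and x0: "x0 > 0"
  obtains H u where "thin (6 / q) H" and "T \<le> u" and "H \<subseteq> {T..u - 2}"
    and "\<And>x t. x \<in> {x0..x0 * (1 + 1 / (4 * q))} \<Longrightarrow> t \<in> {t0..t0 + 1 / q} \<Longrightarrow> \<exists>n. x * a n + t \<in> H"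
proof -
  define \<eta> where "\<eta> = 1 / (4 * real q)"
  have \<eta>: "\<eta> > 0" using q by (simp add: \<eta>_def)
  obtain g where g0: "max ((T - t0) / x0) (3 / (x0 * \<eta>)) \<le> a (g 0)" "0 < a (g 0)"
    and g: "\<And>n. (1 + 2 * \<eta>) * a (g n) \<le> a (g (Suc n))" "\<And>n. a (g (Suc n)) \<le> (1 + 3 * \<eta>) * a (g n)"
  proof (rule geometric_subsequence[OF inc unb sub, where B = "max ((T - t0) / x0) (3 / (x0 * \<eta>))"])
    show "1 < 1 + 2 * \<eta>" "1 + 2 * \<eta> < 1 + 3 * \<eta>"
      using \<eta> by simp_all
  qed (rule that)
  define b where "b n = a (g n)" for n
  define l where "l n = x0 * b n + t0" for n
  have b_pos: "0 < b n" for n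
  proof (induction n)
    case (Suc n)
    have "0 < (1 + 2 * \<eta>) * b n" using Suc \<eta> by simp
    then show ?case using g(1)[of n] unfolding b_def by linarith
  qed (simp add: b_def g0)
  have incb: "incseq b"
  proof (rule incseq_SucI)
    fix n
    have "b n \<le> (1 + 2 * \<eta>) * b n" using b_pos[of n] \<eta> by simp
    then show "b n \<le> b (Suc n)" using g(1)[of n] unfolding b_def by linarith
  qed
  have incl: "incseq l"
    using incb x0 unfolding incseq_def l_def by simp
  have b_upper: "b n \<le> b 0 * (1 + 3 * \<eta>) ^ n" for n
  proof (induction n)
    case (Suc n)
    have "b (Suc n) \<le> (1 + 3 * \<eta>) * b n" using g(2) by (simp add: b_def)
    also have "\<dots> \<le> (1 + 3 * \<eta>) * (b 0 * (1 + 3 * \<eta>) ^ n)"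
      using Suc \<eta> by (intro mult_left_mono) auto
    finally show ?case by (simp add: mult_ac)
  qed simp
  have l0: "T \<le> l 0"
    using g0 x0 by (simp add: l_def b_def divide_le_eq mult.commute)
  \<comment> \<open>The points \<open>x * b n + t\<close> with \<open>(x, t)\<close> in the box stay between \<open>l n\<close> and \<open>l (Suc n) - 2\<close>: the
    ratio \<open>1 + 2 * \<eta>\<close> exceeds the spread \<open>1 + \<eta>\<close> of \<open>x\<close>, and \<open>b 0 \<ge> 3 / (x0 * \<eta>)\<close> turns the
    excess into a gap of length at least \<open>3\<close>.\<close>
  have room: "x0 * (1 + \<eta>) * b n + t0 + 1 \<le> l (Suc n) - 2" for n
  proof -
    have "3 \<le> x0 * \<eta> * b 0"
      using g0 x0 \<eta> by (simp add: b_def divide_le_eq mult.commute)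
    also have "\<dots> \<le> x0 * \<eta> * b n"
      using incseqD[OF incb, of 0 n] x0 \<eta> by (intro mult_left_mono) auto
    finally have "3 \<le> x0 * \<eta> * b n" .
    moreover have "x0 * ((1 + 2 * \<eta>) * b n) \<le> x0 * b (Suc n)"
      using g(1)[of n] x0 unfolding b_def by (intro mult_left_mono) auto
    ultimately show ?thesis
      by (simp add: l_def algebra_simps)
  qed
  \<comment> \<open>\<open>C * (1 + 3 * \<eta>) ^ N + 2\<close> bounds the size of the grid \<open>P\<close> of values of \<open>x\<close> below.\<close>
  define C where "C = x0 * \<eta> * real q * b 0"
  have "(\<lambda>N. ((1 + 3 * \<eta>) * (1 - 1 / real q)) ^ N) \<longlonglongrightarrow> 0"
  proof (rule LIMSEQ_realpow_zero)
    show "(1 + 3 * \<eta>) * (1 - 1 / real q) < 1"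
    proof -
      have "(1 + 3 * \<eta>) * (1 - 1 / real q) = 1 - 1 / (4 * real q) - 3 / (4 * real q * real q)"
        using q by (simp add: \<eta>_def field_simps)
      also have "\<dots> < 1"
        using q by (simp add: diff_less_eq add_pos_pos)
      finally show ?thesis .
    qed
    show "0 \<le> (1 + 3 * \<eta>) * (1 - 1 / real q)"
      using q \<eta> by (intro mult_nonneg_nonneg) auto
  qed
  moreover have "(\<lambda>N. (1 - 1 / real q) ^ N) \<longlonglongrightarrow> 0"
    by (rule LIMSEQ_realpow_zero) (use q in auto)
  ultimately have "(\<lambda>N. C * ((1 + 3 * \<eta>) * (1 - 1 / real q)) ^ N + 2 * (1 - 1 / real q) ^ N)
      \<longlonglongrightarrow> C * 0 + 2 * 0"
    by (intro tendsto_add tendsto_mult_left)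
  then have "\<forall>\<^sub>F N in sequentially.
      C * ((1 + 3 * \<eta>) * (1 - 1 / real q)) ^ N + 2 * (1 - 1 / real q) ^ N < 1"
    by (rule order_tendstoD) simp
  then obtain N where N: "C * ((1 + 3 * \<eta>) * (1 - 1 / real q)) ^ N + 2 * (1 - 1 / real q) ^ N < 1"
    by (auto simp: eventually_sequentially)
  define M where "M = nat \<lceil>x0 * \<eta> * real q * b N\<rceil>"
  define P where "P = (\<lambda>j::nat. x0 + j / (q * b N)) ` {..M}"
  have "real (card P) \<le> real (M + 1)"
    unfolding P_def using card_image_le[of "{..M}"] by (metis Suc_eq_plus1 card_atMost finite_atMost of_nat_le_iff)
  also have "real (M + 1) \<le> x0 * \<eta> * real q * b N + 2"
    using x0 \<eta> b_pos[of N] unfolding M_def by (simp add: of_nat_nat) linarith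
  also have "\<dots> \<le> C * (1 + 3 * \<eta>) ^ N + 2"
    using mult_left_mono[OF b_upper[of N], of "x0 * \<eta> * real q"] x0 \<eta> by (simp add: C_def mult_ac)
  finally have "real (card P) * (1 - 1 / real q) ^ N \<le> (C * (1 + 3 * \<eta>) ^ N + 2) * (1 - 1 / real q) ^ N"
    using q by (intro mult_right_mono) auto
  also have "\<dots> < 1"
    using N unfolding power_mult_distrib by (simp only: distrib_right mult.assoc)
  finally have card_P: "real (card P) * (1 - 1 / real q) ^ N < 1" .
  \<comment> \<open>The colour of \<open>p\<close> at step \<open>n\<close> is the index of the cell that contains \<open>p * b n + t0\<close>.\<close>
  obtain r where r: "\<And>p. p \<in> P \<Longrightarrow> \<exists>n<N. nat \<lfloor>real q * frac (p * b n + t0)\<rfloor> = r n"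
    by (rule greedy_hitting[OF _ _ _ card_P, where c = "\<lambda>n p. nat \<lfloor>real q * frac (p * b n + t0)\<rfloor>"])
      (use q in \<open>auto simp: P_def intro: nat_floor_frac_less\<close>)
  define F where "F n = (if n < N then comb q (r n) \<inter> {l n..l (Suc n) - 2} else {})" for n
  have thin_F: "thin (6 / q) (F n)" for n
    using thin_subset[OF thin_comb[OF q, of "r n"], of "F n"] thin_comb[OF q, of "r n"]
    by (auto simp: F_def thin_def)
  show thesis
  proof (rule that[of "\<Union>n. F n" "l N"])
    show "thin (6 / q) (\<Union>n. F n)"
      by (rule thin_UN_separated[OF thin_F incl]) (auto simp: F_def)
    show "T \<le> l N"
      using l0 incseqD[OF incl, of 0 N] by simp
    show "(\<Union>n. F n) \<subseteq> {T..l N - 2}"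
    proof
      fix y assume "y \<in> (\<Union>n. F n)"
      then obtain n where "n < N" "l n \<le> y" "y \<le> l (Suc n) - 2"
        by (auto simp: F_def split: if_splits)
      then show "y \<in> {T..l N - 2}"
        using l0 incseqD[OF incl, of 0 n] incseqD[OF incl, of "Suc n" N] by auto
    qed
    fix x t assume x: "x \<in> {x0..x0 * (1 + 1 / (4 * q))}" and t: "t \<in> {t0..t0 + 1 / q}"
    have x': "x0 \<le> x" "x \<le> x0 * (1 + \<eta>)" using x by (auto simp: \<eta>_def)
    \<comment> \<open>Round \<open>x\<close> down to a grid point \<open>p\<close>. The mesh is chosen for the largest factor \<open>b N\<close>, so that
      \<open>x * b n\<close> and \<open>p * b n\<close> differ by at most \<open>1 / q\<close> for every \<open>n < N\<close>.\<close>
    have qb: "real q * b N > 0" using q b_pos by simp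
    define j where "j = nat \<lfloor>(x - x0) * (q * b N)\<rfloor>"
    define p where "p = x0 + j / (q * b N)"
    have "(x - x0) * (q * b N) \<le> x0 * \<eta> * (q * b N)"
      using x' qb by (intro mult_right_mono) (auto simp: algebra_simps)
    then have "j \<le> M"
      unfolding j_def M_def by (intro nat_mono) (simp add: mult_ac, linarith)
    then have "p \<in> P"
      by (auto simp: P_def p_def)
    then obtain n where n: "n < N" "nat \<lfloor>real q * frac (p * b n + t0)\<rfloor> = r n"
      using r by blast
    have "0 \<le> (x - x0) * (q * b N)"
      using x' qb by simp
    then have "real j \<le> (x - x0) * (q * b N)" "(x - x0) * (q * b N) \<le> real j + 1"
      unfolding j_def by linarith+
    then have "real j / (q * b N) \<le> x - x0" "x - x0 \<le> (real j + 1) / (q * b N)"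
      using qb by (simp_all add: pos_divide_le_eq pos_le_divide_eq)
    then have p: "p \<le> x" "x - p \<le> 1 / (q * b N)"
      by (simp_all add: p_def add_divide_distrib)
    have "(x - p) * b n \<le> 1 / (q * b N) * b N"
      using p incseqD[OF incb, of n N] n b_pos[of n] qb by (intro mult_mono) auto
    also have "\<dots> = 1 / q"
      using b_pos[of N] by simp
    finally have "(x - p) * b n \<le> 1 / q" .
    moreover have "0 \<le> (x - p) * b n"
      using p b_pos[of n] by simp
    ultimately have "x * b n + t \<in> comb q (r n)"
      unfolding n(2)[symmetric] using q t by (intro mem_comb_near) (auto simp: algebra_simps)
    moreover have "x0 * b n \<le> x * b n" "x * b n \<le> x0 * (1 + \<eta>) * b n"
      using x' b_pos[of n] by (auto intro: mult_right_mono)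
    moreover have "1 / real q \<le> 1"
      using q by simp
    then have "t \<le> t0 + 1"
      using t by simp
    ultimately have "x * b n + t \<in> F n"
      using room[of n] t n(1) by (auto simp: F_def l_def)
    then show "\<exists>n. x * a n + t \<in> (\<Union>n. F n)"
      unfolding b_def by blast
  qed
qed

text \<open>
  Boxes with rational corners \<open>(X k, Y k)\<close> cover all parameters with \<open>x > 0\<close>. Their size relative to
  the corner is fixed by \<open>q\<close> alone, and the pieces that belong to them are lined up from left to right.
\<close>

lemma exists_thin_hitting_positive:
  fixes a :: "nat \<Rightarrow> real" and q :: nat
  assumes "incseq a" and "\<not> bounded (range a)" and "sublacunary a" and q: "q \<ge> 3"
  obtains H where "thin (6 / q) H" and "\<And>x t. x > 0 \<Longrightarrow> \<exists>n. x * a n + t \<in> H"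
proof -
  define X where "X k = real_of_rat (fst (from_nat k :: rat \<times> rat))" for k
  define Y where "Y k = real_of_rat (snd (from_nat k :: rat \<times> rat))" for k
  define Q where "Q k T H u \<longleftrightarrow> thin (6 / q) H \<and> T \<le> u \<and> H \<subseteq> {T..u - 2} \<and>
      (0 < X k \<longrightarrow> (\<forall>x\<in>{X k..X k * (1 + 1 / (4 * q))}. \<forall>t\<in>{Y k..Y k + 1 / q}. \<exists>n. x * a n + t \<in> H))"
    for k T H u
  have "\<exists>H u. Q k T H u" for k T
  proof (cases "0 < X k")
    case True
    show ?thesis
      by (rule exists_thin_hitting_box[OF assms True, of T "Y k"]) (unfold Q_def, blast)
  next
    case False
    then have "Q k T {} T"
      using thin_empty[of "6 / q"] by (simp add: Q_def)
    then show ?thesis by blast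
  qed
  then obtain F U where FU: "\<And>k T. Q k T (F k T) (U k T)"
    by metis
  have F: "thin (6 / q) (F k T)" "T \<le> U k T" "F k T \<subseteq> {T..U k T - 2}" for k T
    using FU[of k T] by (simp_all add: Q_def)
  have hit: "\<exists>n. x * a n + t \<in> F k T"
    if "0 < X k" "x \<in> {X k..X k * (1 + 1 / (4 * q))}" "t \<in> {Y k..Y k + 1 / q}" for k T x t
    using FU[of k T] that unfolding Q_def by blast
  \<comment> \<open>The piece of box \<open>k\<close> lives to the right of \<open>L k\<close>.\<close>
  define L where "L = rec_nat (0::real) U"
  have L: "L (Suc k) = U k (L k)" for k
    by (simp add: L_def)
  show thesis
  proof (rule that[of "\<Union>k. F k (L k)"])
    show "thin (6 / q) (\<Union>k. F k (L k))"
      by (rule thin_UN_separated[of _ _ L]) (use F in \<open>auto simp: L intro: incseq_SucI\<close>)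
    fix x t :: real assume x: "0 < x"
    have e: "1 < 1 + 1 / (4 * real q)" "0 < 1 + 1 / (4 * real q)" "0 < 1 / real q"
      using q by (auto intro: add_pos_pos)
    have "x < x * (1 + 1 / (4 * real q))"
      using x e(1) by simp
    then have "x / (1 + 1 / (4 * real q)) < x"
      using e(2) by (simp only: pos_divide_less_eq)
    then obtain y where y: "x / (1 + 1 / (4 * real q)) < real_of_rat y" "real_of_rat y < x"
      using of_rat_dense by blast
    obtain s where s: "t - 1 / q < real_of_rat s" "real_of_rat s < t"
      using of_rat_dense[of "t - 1 / q" t] e by auto
    obtain k where k: "from_nat k = (y, s)"
      by (metis from_nat_to_nat)
    have "0 < x / (1 + 1 / (4 * real q))"
      using x e(2) by (rule divide_pos_pos)
    then have "0 < real_of_rat y"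
      using y(1) by linarith
    moreover have "x \<le> real_of_rat y * (1 + 1 / (4 * real q))"
      using y(1) e(2) by (simp only: pos_divide_less_eq less_imp_le)
    ultimately have "\<exists>n. x * a n + t \<in> F k (L k)"
      using y s by (intro hit) (auto simp: X_def Y_def k)
    then show "\<exists>n. x * a n + t \<in> (\<Union>k. F k (L k))"
      by blast
  qed
qed

theorem corollary1p4:
  fixes a :: "nat \<Rightarrow> real" and \<epsilon> :: real
  assumes "incseq a"
    and "\<not> bounded (range a)"
    and "sublacunary a"
    and "0 < \<epsilon>" and "\<epsilon> \<le> 1"
  shows "\<exists>S. large_set (1 - \<epsilon>) S \<and> \<not> (\<exists>C. affine_copy a C \<and> C \<subseteq> S)"
proof -
  obtain q :: nat where q: "12 / \<epsilon> \<le> q" "q \<ge> 3"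
    using real_arch_simple[of "max (12 / \<epsilon>) 3"] by auto
  obtain H where H: "thin (6 / q) H" and hit: "\<And>x t. x > 0 \<Longrightarrow> \<exists>n. x * a n + t \<in> H"
    using exists_thin_hitting_positive[OF assms(1-3) q(2)] by blast
  define S where "S = - (H \<union> uminus ` H)"
  have "large_set (1 - (6 / q + 6 / q)) S"
    unfolding S_def by (intro large_set_Compl_thin thin_Un thin_uminus H)
  moreover have "6 / q + 6 / q \<le> \<epsilon>"
    using q assms(4) by (simp add: field_simps)
  ultimately have "large_set (1 - \<epsilon>) S"
    unfolding large_set_def by (meson diff_left_mono order_trans)
  moreover have False if C: "affine_copy a C" "C \<subseteq> S" for C
  proof -
    obtain x t where x: "x \<noteq> 0" and "C = range (\<lambda>n. x * a n + t)"
      using C(1) unfolding affine_copy_def by blast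
    then have miss: "x * a n + t \<notin> H" "x * a n + t \<notin> uminus ` H" for n
      using C(2) unfolding S_def by blast+
    show False
    proof (cases "x > 0")
      case True
      then show False using hit miss(1) by blast
    next
      case False
      then obtain n where "(- x) * a n + (- t) \<in> H"
        using hit[of "- x" "- t"] x by auto
      then have "- ((- x) * a n + (- t)) \<in> uminus ` H"
        by (rule imageI)
      then show False
        using miss(2)[of n] by (simp add: add.commute)
    qed
  qed
  ultimately show ?thesis
    by blast
qed

end
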